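(* There exists a compact set $F\subseteq\mathbb{R}^2$ such that for all dimension functions $\phi$, $$\dim_{\mathrm L}^{\phi}F=\underline{\dim}_{\mathrm L}^{\phi}F<\dim_{\mathrm{ML}}^{\phi}F<\underline{\dim}_{\mathrm B}F.$$
   Context: $B(x,R)$ is the ball of centre $x$ and radius $R$, and $N_r(E)$ is the smallest number of balls of radius $r$ needed to cover $E$. $\underline{\dim}_{\mathrm B}$ is the lower box dimension. A dimension function is a function $\phi:(0,1)\to(0,\infty)$ such that $\phi(R)$ decreases as $R\to0$, and $\phi(R)\log(1/R)$ increases to infinity as $R$ decreases to $0$ (monotonicity in the non-strict sense, so constant functions are allowed). For a non-empty bounded set $F$, the $\phi$-lower dimension is $$\dim_{\mathrm L}^{\phi}F=\sup\Big\{s\ge0:\ \exists\,C>0 \text{ such that } \forall\, 0<R<1,\ \inf_{x\in F}N_{R^{1+\phi(R)}}(B(x,R)\cap F)\ge C\,R^{-\phi(R)s}\Big\},$$ the quasi $\phi$-lower dimension is $$\underline{\dim}_{\mathrm L}^{\phi}F=\sup\Big\{s\ge0:\ \exists\,C>0 \text{ such that } \forall\, 0<r\le R^{1+\phi(R)}<R<1,\ \inf_{x\in F}N_{r}(B(x,R)\cap F)\ge C\,(R/r)^{s}\Big\},$$ and the $\phi$-modified lower dimension is $$\dim_{\mathrm{ML}}^{\phi}F=\sup\{\dim_{\mathrm L}^{\phi}E:\ \emptyset\ne E\subseteq F\}.$$ *)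

theory Defs
  imports "HOL-Analysis.Analysis"
begin

text \<open>
  Balls are closed, and the centres of a cover may be arbitrary points of the ambient space.
  For bounded \<open>E\<close> and \<open>r > 0\<close> a finite cover exists, so the infimum is taken over a non-empty
  set of natural numbers and is attained; other arguments are not used.
\<close>

definition covering_number :: "real \<Rightarrow> 'a::euclidean_space set \<Rightarrow> nat" where
  "covering_number r E =
     Inf {card A | A. finite A \<and> E \<subseteq> (\<Union>a\<in>A. cball a r)}"

text \<open>
  Only the values on the open unit interval matter. Both monotonicity conditions are
  non-strict and are read as the argument decreases to \<open>0\<close>.
\<close>

definition dimension_function :: "(real \<Rightarrow> real) \<Rightarrow> bool" where
  "dimension_function \<phi> \<longleftrightarrow>
     (\<forall>R\<in>{0<..<1}. 0 < \<phi> R) \<and>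
     mono_on {0<..<1} \<phi> \<and>
     antimono_on {0<..<1} (\<lambda>R. \<phi> R * ln (1 / R)) \<and>
     filterlim (\<lambda>R. \<phi> R * ln (1 / R)) at_top (at_right 0)"

text \<open>
  The dimensions below are meant for non-empty bounded sets. They are extended reals, so that
  no supremum or limit inferior depends on a boundedness side condition.
\<close>

definition phi_lower_dim :: "(real \<Rightarrow> real) \<Rightarrow> 'a::euclidean_space set \<Rightarrow> ereal" where
  "phi_lower_dim \<phi> F =
     Sup (ereal ` {s. 0 \<le> s \<and>
       (\<exists>C>0. \<forall>R. 0 < R \<and> R < 1 \<longrightarrow>
          real (INF x\<in>F. covering_number (R powr (1 + \<phi> R)) (cball x R \<inter> F))
            \<ge> C * R powr (- \<phi> R * s))})"

definition quasi_phi_lower_dim :: "(real \<Rightarrow> real) \<Rightarrow> 'a::euclidean_space set \<Rightarrow> ereal" where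
  "quasi_phi_lower_dim \<phi> F =
     Sup (ereal ` {s. 0 \<le> s \<and>
       (\<exists>C>0. \<forall>r R. 0 < r \<and> r \<le> R powr (1 + \<phi> R) \<and> R powr (1 + \<phi> R) < R \<and> 0 < R \<and> R < 1 \<longrightarrow>
          real (INF x\<in>F. covering_number r (cball x R \<inter> F)) \<ge> C * (R / r) powr s)})"

definition phi_modified_lower_dim :: "(real \<Rightarrow> real) \<Rightarrow> 'a::euclidean_space set \<Rightarrow> ereal" where
  "phi_modified_lower_dim \<phi> F = Sup {phi_lower_dim \<phi> E | E. E \<noteq> {} \<and> E \<subseteq> F}"

definition lower_box_dim :: "'a::euclidean_space set \<Rightarrow> ereal" where
  "lower_box_dim F =
     Liminf (at_right 0) (\<lambda>r. ereal (ln (real (covering_number r F)) / ln (1 / r)))"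

end

theory Submission
  imports Defs "HOL-Real_Asymp.Real_Asymp"
begin

text \<open>
  The set is the unit segment on the horizontal axis together with rows of isolated points
  accumulating on it: row \<open>n \<ge> 1\<close> has height \<open>1 / n\<close> and consists of points spaced \<open>1 / n\<^sup>2\<close> apart.

  A set with an isolated point \<open>p\<close> has \<open>\<phi>\<close>-lower dimension \<open>0\<close>: small balls around \<open>p\<close> need a
  single covering ball, whereas \<open>R\<^bsup>-\<phi>(R)\<^esup>\<close> tends to infinity
  (\<open>phi_lower_dim_isolated_le_0\<close>). This applies to the whole set, whose quasi \<open>\<phi>\<close>-lower dimension
  is squeezed between \<open>0\<close> and the \<open>\<phi>\<close>-lower dimension, and also to every subset that contains one of
  the row points. The remaining subsets lie on a line and have dimension at most
  \<open>1\<close> (\<open>phi_lower_dim_line_le_1\<close>), while the segment itself has dimension at least \<open>1\<close>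
  (\<open>phi_lower_dim_segment_ge_1\<close>). So the modified lower dimension is \<open>1\<close>. The rows are too thin
  to be seen by it, but they are dense enough to raise the box dimension: rows \<open>N + 1, \<dots>, 2 N\<close>
  contain at least \<open>N\<^sup>3\<close> points at mutual distances at least \<open>1 / (8 N\<^sup>2)\<close>, which forces lower box
  dimension at least \<open>3 / 2\<close>; the cruder bound \<open>5 / 4\<close> suffices (\<open>lower_box_dim_comb_ge\<close>).
\<close>

section \<open>Covering numbers\<close>

lemma covering_number_le:
  assumes "finite A" "E \<subseteq> (\<Union>a\<in>A. cball a r)"
  shows "covering_number r E \<le> card A"
  unfolding covering_number_def by (rule cInf_lower) (use assms in auto)

lemma covering_number_attained:
  fixes E :: "'a::euclidean_space set"
  assumes "bounded E" "r > 0"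
  obtains A where "finite A" "E \<subseteq> (\<Union>a\<in>A. cball a r)" "covering_number r E = card A"
proof -
  let ?M = "{card A | A :: 'a set. finite A \<and> E \<subseteq> (\<Union>a\<in>A. cball a r)}"
  have "compact (closure E)"
    using assms(1) by simp
  then obtain K where "finite K" "closure E \<subseteq> (\<Union>x\<in>K. ball x r)"
    using assms(2) unfolding compact_eq_totally_bounded by meson
  then have "E \<subseteq> (\<Union>a\<in>K. cball a r)"
    using closure_subset[of E] ball_subset_cball by blast
  with \<open>finite K\<close> have "?M \<noteq> {}" by blast
  then have "Inf ?M \<in> ?M" by (rule Inf_nat_def1)
  then show thesis
    using that unfolding covering_number_def by auto
qed

text \<open>
  A ball of radius \<open>r\<close> has diameter \<open>2 r\<close>, so it contains at most one point of a set whose points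
  are more than \<open>2 r\<close> apart.
\<close>

lemma covering_number_ge_separated:
  fixes E :: "'a::euclidean_space set"
  assumes "bounded E" "r > 0" "S \<subseteq> E"
    and sep: "\<And>x y. x \<in> S \<Longrightarrow> y \<in> S \<Longrightarrow> x \<noteq> y \<Longrightarrow> dist x y > 2 * r"
  shows "card S \<le> covering_number r E"
proof -
  obtain A where A: "finite A" "E \<subseteq> (\<Union>a\<in>A. cball a r)" "covering_number r E = card A"
    using covering_number_attained[OF assms(1,2)] .
  have "\<forall>x\<in>S. \<exists>a\<in>A. dist a x \<le> r"
    using A(2) assms(3) by (force simp: subset_iff)
  then obtain c where c: "\<And>x. x \<in> S \<Longrightarrow> c x \<in> A" "\<And>x. x \<in> S \<Longrightarrow> dist (c x) x \<le> r"
    by metis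
  have "inj_on c S"
  proof (rule inj_onI, rule ccontr)
    fix x y assume xy: "x \<in> S" "y \<in> S" "c x = c y" "x \<noteq> y"
    have "dist x y \<le> dist (c x) x + dist (c y) y"
      using dist_triangle3[of x y "c x"] xy(3) by simp
    with c(2)[OF xy(1)] c(2)[OF xy(2)] sep[OF xy(1,2,4)] show False by linarith
  qed
  then show ?thesis
    using card_inj_on_le[of c S A] c(1) A(1,3) by auto
qed

lemma covering_number_pos:
  fixes E :: "'a::euclidean_space set"
  assumes "bounded E" "r > 0" "E \<noteq> {}"
  shows "1 \<le> covering_number r E"
proof -
  obtain x where "x \<in> E" using assms(3) by blast
  then show ?thesis
    using covering_number_ge_separated[OF assms(1,2), of "{x}"] by simp
qed

lemma INF_covering_number_le:
  assumes "x \<in> E"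
  shows "(INF x\<in>E. covering_number r (cball x R \<inter> E)) \<le> covering_number r (cball x R \<inter> E)"
  by (rule cINF_lower) (use assms in auto)

lemma INF_covering_number_pos:
  fixes E :: "'a::euclidean_space set"
  assumes "E \<noteq> {}" "r > 0" "R > 0"
  shows "1 \<le> (INF x\<in>E. covering_number r (cball x R \<inter> E))"
proof (rule cINF_greatest[OF assms(1)])
  fix x assume "x \<in> E"
  with assms(3) have "x \<in> cball x R \<inter> E" by simp
  then have "cball x R \<inter> E \<noteq> {}" by blast
  then show "1 \<le> covering_number r (cball x R \<inter> E)"
    by (intro covering_number_pos assms) (auto intro: bounded_Int)
qed

section \<open>Comparing exponents\<close>

lemma filterlim_powr_dimension_function:
  assumes "dimension_function \<phi>"
  shows "filterlim (\<lambda>R. R powr (- \<phi> R)) at_top (at_right 0)"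
proof -
  have "filterlim (\<lambda>R. exp (\<phi> R * ln (1 / R))) at_top (at_right 0)"
    using assms unfolding dimension_function_def
    by (intro filterlim_compose[OF exp_at_top]) blast
  moreover have "\<forall>\<^sub>F R in at_right 0. exp (\<phi> R * ln (1 / R)) = R powr (- \<phi> R)"
    using eventually_at_right_less[of "0::real"]
    by eventually_elim (auto simp: powr_def ln_div)
  ultimately show ?thesis
    by (simp only: filterlim_cong[OF refl refl])
qed

text \<open>
  Since \<open>R\<^bsup>-\<phi>(R)\<^esup>\<close> tends to infinity, a higher power of it is not bounded by a multiple of a
  lower one.
\<close>

lemma exponent_le_if_powr_le:
  assumes \<phi>: "dimension_function \<phi>" and "C > 0"
    and le: "\<forall>\<^sub>F R in at_right 0. C * R powr (- \<phi> R * s) \<le> K * R powr (- \<phi> R * t)"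
  shows "s \<le> t"
proof (rule ccontr)
  assume "\<not> s \<le> t"
  then have st: "s - t > 0" by simp
  have "filterlim (\<lambda>R. (R powr (- \<phi> R)) powr (s - t)) at_top (at_right 0)"
    by (rule filterlim_compose[OF real_powr_at_top[OF st]
          filterlim_powr_dimension_function[OF \<phi>]])
  then have "\<forall>\<^sub>F R in at_right 0. (R powr (- \<phi> R)) powr (s - t) > K / C"
    unfolding filterlim_at_top_dense by blast
  with le eventually_at_right_less[of "0::real"] have "\<forall>\<^sub>F R::real in at_right 0. False"
  proof eventually_elim
    case (elim R)
    define T where "T = R powr (- \<phi> R)"
    have "T > 0" using elim by (simp add: T_def)
    have "C * T powr s \<le> K * T powr t"
      using elim by (simp add: T_def powr_powr)
    moreover have "T powr s = T powr (s - t) * T powr t"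
      by (simp flip: powr_add)
    ultimately have "C * T powr (s - t) \<le> K"
      using \<open>T > 0\<close> by (simp flip: mult.assoc)
    with elim \<open>C > 0\<close> show False
      by (simp add: T_def field_simps)
  qed
  then show False by simp
qed

lemma phi_lower_dim_leI:
  fixes E :: "'a::euclidean_space set"
  assumes \<phi>: "dimension_function \<phi>"
    and le: "\<forall>\<^sub>F R in at_right 0.
      real (INF x\<in>E. covering_number (R powr (1 + \<phi> R)) (cball x R \<inter> E)) \<le> K * R powr (- \<phi> R * t)"
  shows "phi_lower_dim \<phi> E \<le> ereal t"
  unfolding phi_lower_dim_def
proof (rule Sup_least, clarify)
  fix s C :: real
  assume C: "C > 0" "\<forall>R. 0 < R \<and> R < 1 \<longrightarrow>
      C * R powr (- \<phi> R * s)
        \<le> real (INF x\<in>E. covering_number (R powr (1 + \<phi> R)) (cball x R \<inter> E))"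
  have "\<forall>\<^sub>F R::real in at_right 0. 0 < R \<and> R < 1"
    by (intro eventually_conj eventually_at_right_less eventually_at_rightI[of 0 1]) auto
  with le have "\<forall>\<^sub>F R in at_right 0. C * R powr (- \<phi> R * s) \<le> K * R powr (- \<phi> R * t)"
  proof eventually_elim
    case (elim R)
    with C(2) have "C * R powr (- \<phi> R * s)
        \<le> real (INF x\<in>E. covering_number (R powr (1 + \<phi> R)) (cball x R \<inter> E))"
      by blast
    also note elim(1)
    finally show ?case .
  qed
  then show "ereal s \<le> ereal t"
    using exponent_le_if_powr_le[OF \<phi> C(1)] by simp
qed

section \<open>General bounds for the lower dimensions\<close>

text \<open>
  The largest scale \<open>r = R\<^bsup>1+\<phi>(R)\<^esup>\<close> in the quasi \<open>\<phi>\<close>-lower dimension is the one that defines the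
  \<open>\<phi>\<close>-lower dimension.
\<close>

lemma quasi_phi_lower_dim_le_phi_lower_dim:
  fixes E :: "'a::euclidean_space set"
  assumes \<phi>: "dimension_function \<phi>"
  shows "quasi_phi_lower_dim \<phi> E \<le> phi_lower_dim \<phi> E"
  unfolding quasi_phi_lower_dim_def phi_lower_dim_def
proof (intro Sup_subset_mono image_mono Collect_mono impI, elim conjE exE, intro conjI)
  fix s C :: real
  assume C: "C > 0" and le: "\<forall>r R. 0 < r \<and> r \<le> R powr (1 + \<phi> R) \<and> R powr (1 + \<phi> R) < R \<and> 0 < R \<and> R < 1 \<longrightarrow>
      C * (R / r) powr s \<le> real (INF x\<in>E. covering_number r (cball x R \<inter> E))"
  show "\<exists>C>0. \<forall>R. 0 < R \<and> R < 1 \<longrightarrow> C * R powr (- \<phi> R * s)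
      \<le> real (INF x\<in>E. covering_number (R powr (1 + \<phi> R)) (cball x R \<inter> E))"
  proof (intro exI[of _ C] conjI allI impI C, elim conjE)
    fix R :: real assume R: "0 < R" "R < 1"
    then have "\<phi> R > 0" using \<phi> by (auto simp: dimension_function_def)
    with R have "R powr (1 + \<phi> R) < R powr 1" by (intro powr_less_mono') auto
    moreover have "(R / R powr (1 + \<phi> R)) powr s = R powr (- \<phi> R * s)"
    proof -
      have "R / R powr (1 + \<phi> R) = R powr (- \<phi> R)"
        using R by (simp add: powr_add powr_minus field_simps)
      then show ?thesis by (simp add: powr_powr)
    qed
    ultimately show "C * R powr (- \<phi> R * s)
      \<le> real (INF x\<in>E. covering_number (R powr (1 + \<phi> R)) (cball x R \<inter> E))"
      using le[rule_format, of "R powr (1 + \<phi> R)" R] R by simp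
  qed
qed

lemma quasi_phi_lower_dim_nonneg:
  fixes E :: "'a::euclidean_space set"
  assumes "E \<noteq> {}"
  shows "0 \<le> quasi_phi_lower_dim \<phi> E"
  unfolding quasi_phi_lower_dim_def zero_ereal_def
proof (intro Sup_upper imageI CollectI conjI exI[of _ 1] allI impI)
  fix r R :: real
  assume *: "0 < r \<and> r \<le> R powr (1 + \<phi> R) \<and> R powr (1 + \<phi> R) < R \<and> 0 < R \<and> R < 1"
  then have "(R / r) powr 0 = 1" by simp
  then show "1 * (R / r) powr 0 \<le> real (INF x\<in>E. covering_number r (cball x R \<inter> E))"
    using INF_covering_number_pos[OF assms, of r R] * by simp
qed auto

lemma phi_lower_dim_isolated_le_0:
  fixes E :: "'a::euclidean_space set"
  assumes \<phi>: "dimension_function \<phi>" and "p \<in> E" "\<epsilon> > 0"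
    and isolated: "\<And>q. q \<in> E \<Longrightarrow> q \<noteq> p \<Longrightarrow> dist p q \<ge> \<epsilon>"
  shows "phi_lower_dim \<phi> E \<le> 0"
proof -
  have "\<forall>\<^sub>F R::real in at_right 0. 0 < R \<and> R < \<epsilon>"
    by (intro eventually_conj eventually_at_right_less eventually_at_rightI[of 0 \<epsilon>])
      (use assms in auto)
  then have "\<forall>\<^sub>F R in at_right 0.
      real (INF x\<in>E. covering_number (R powr (1 + \<phi> R)) (cball x R \<inter> E)) \<le> 1 * R powr (- \<phi> R * 0)"
  proof eventually_elim
    case (elim R)
    have "cball p R \<inter> E \<subseteq> (\<Union>a\<in>{p}. cball a (R powr (1 + \<phi> R)))"
      using isolated elim by (force simp: mem_cball)
    then have "covering_number (R powr (1 + \<phi> R)) (cball p R \<inter> E) \<le> 1"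
      using covering_number_le[of "{p}"] by simp
    with INF_covering_number_le[OF \<open>p \<in> E\<close>, of "R powr (1 + \<phi> R)" R] elim show ?case by simp
  qed
  from phi_lower_dim_leI[OF \<phi> this] show ?thesis by (simp add: zero_ereal_def)
qed

text \<open>
  An interval of length \<open>2 R\<close> is covered by about \<open>2 R / \<delta>\<close> balls of radius \<open>\<delta> = R\<^bsup>1+\<phi>(R)\<^esup>\<close>, and
  \<open>R / \<delta> = R\<^bsup>-\<phi>(R)\<^esup>\<close>. The map \<open>f\<close> is an isometric parametrisation of the line.
\<close>

lemma phi_lower_dim_line_le_1:
  fixes E :: "'a::euclidean_space set" and f :: "real \<Rightarrow> 'a"
  assumes \<phi>: "dimension_function \<phi>" and "E \<noteq> {}" "E \<subseteq> range f"
    and iso: "\<And>s t. dist (f s) (f t) = \<bar>s - t\<bar>"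
  shows "phi_lower_dim \<phi> E \<le> 1"
proof -
  obtain a where a: "f a \<in> E" using assms(2,3) by blast
  have "\<forall>\<^sub>F R::real in at_right 0. 0 < R \<and> R < 1"
    by (intro eventually_conj eventually_at_right_less eventually_at_rightI[of 0 1]) auto
  then have "\<forall>\<^sub>F R in at_right 0.
      real (INF x\<in>E. covering_number (R powr (1 + \<phi> R)) (cball x R \<inter> E)) \<le> 3 * R powr (- \<phi> R * 1)"
  proof eventually_elim
    case (elim R)
    define \<delta> where "\<delta> = R powr (1 + \<phi> R)"
    have \<delta>: "\<delta> > 0" using elim by (simp add: \<delta>_def)
    have ratio: "R powr (- \<phi> R) = R / \<delta>"
      using elim by (simp add: \<delta>_def powr_add powr_minus field_simps)
    have "\<phi> R > 0" using elim \<phi> by (auto simp: dimension_function_def)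
    with elim have "\<delta> < R powr 1" unfolding \<delta>_def by (intro powr_less_mono') auto
    with elim have "\<delta> < R" by simp
    define m where "m = nat \<lfloor>2 * R / \<delta>\<rfloor>"
    have "cball (f a) R \<inter> E \<subseteq> (\<Union>c\<in>(\<lambda>i. f (a - R + real i * \<delta>)) ` {..m}. cball c \<delta>)"
    proof
      fix q assume q: "q \<in> cball (f a) R \<inter> E"
      then obtain t where t: "q = f t" using assms(3) by blast
      define u where "u = t - (a - R)"
      have u: "0 \<le> u" "u \<le> 2 * R" using q by (auto simp: t iso u_def)
      define i where "i = nat \<lfloor>u / \<delta>\<rfloor>"
      have "real i \<le> u / \<delta>" "u / \<delta> < real i + 1"
        using u \<delta> by (simp_all add: i_def)
      then have "real i * \<delta> \<le> u" "u < real i * \<delta> + \<delta>"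
        using \<delta> by (simp_all add: field_simps)
      then have "q \<in> cball (f (a - R + real i * \<delta>)) \<delta>"
        by (simp add: t iso u_def)
      moreover have "i \<le> m"
        unfolding i_def m_def using u \<delta> by (intro nat_mono floor_mono divide_right_mono) auto
      ultimately show "q \<in> (\<Union>c\<in>(\<lambda>i. f (a - R + real i * \<delta>)) ` {..m}. cball c \<delta>)"
        by blast
    qed
    then have "covering_number \<delta> (cball (f a) R \<inter> E) \<le> card ((\<lambda>i. f (a - R + real i * \<delta>)) ` {..m})"
      by (intro covering_number_le) auto
    also have "\<dots> \<le> m + 1"
      using card_image_le[of "{..m}"] by fastforce
    finally have "real (INF x\<in>E. covering_number \<delta> (cball x R \<inter> E)) \<le> real m + 1"
      using INF_covering_number_le[OF a, of \<delta> R] by linarith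
    also have "real m \<le> 2 * R / \<delta>"
      using elim \<delta> by (simp add: m_def)
    also have "2 * R / \<delta> + 1 \<le> 3 * (R / \<delta>)"
      using \<delta> \<open>\<delta> < R\<close> by (simp add: field_simps)
    finally show ?case by (simp add: \<delta>_def[symmetric] ratio)
  qed
  from phi_lower_dim_leI[OF \<phi> this] show ?thesis by (simp add: one_ereal_def)
qed

text \<open>
  A ball of radius \<open>R < 1\<close> around a point of the unit segment meets it in a segment of length at
  least \<open>R / 2\<close>, which contains about \<open>R / (6 \<delta>)\<close> points spaced \<open>3 \<delta>\<close> apart.
\<close>

lemma phi_lower_dim_segment_ge_1:
  fixes f :: "real \<Rightarrow> 'a::euclidean_space"
  assumes iso: "\<And>s t. dist (f s) (f t) = \<bar>s - t\<bar>"
  shows "1 \<le> phi_lower_dim \<phi> (f ` {0..1})"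
  unfolding phi_lower_dim_def one_ereal_def
proof (intro Sup_upper imageI CollectI conjI exI[of _ "1/6"] allI impI)
  fix R :: real assume R: "0 < R \<and> R < 1"
  define \<delta> where "\<delta> = R powr (1 + \<phi> R)"
  have \<delta>: "\<delta> > 0" using R by (simp add: \<delta>_def)
  have ratio: "R powr (- \<phi> R) = R / \<delta>"
    using R by (simp add: \<delta>_def powr_add powr_minus field_simps)
  define m where "m = nat \<lfloor>R / (6 * \<delta>)\<rfloor>"
  have m: "real m \<le> R / (6 * \<delta>)" "R / (6 * \<delta>) < real m + 1"
    using R \<delta> by (simp_all add: m_def)
  have "m + 1 \<le> (INF x\<in>f ` {0..1}. covering_number \<delta> (cball x R \<inter> f ` {0..1}))"
  proof (rule cINF_greatest)
    fix x assume "x \<in> f ` {0..1}"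
    then obtain t where t: "x = f t" "0 \<le> t" "t \<le> 1" by auto
    (* left end of a subinterval of [0, 1] of length R / 2 having t as an end point *)
    define b where "b = (if t \<le> 1 / 2 then t else t - R / 2)"
    define g where "g i = f (b + 3 * \<delta> * real i)" for i :: nat
    have g: "g i \<in> cball x R \<inter> f ` {0..1}" if "i \<le> m" for i
    proof -
      define h where "h = 3 * \<delta> * real i"
      have "real i \<le> R / (6 * \<delta>)" using that m(1) by linarith
      then have "h \<le> R / 2" using \<delta> by (simp add: h_def field_simps)
      moreover have "h \<ge> 0" using \<delta> by (simp add: h_def)
      ultimately have "\<bar>t - (b + h)\<bar> \<le> R" "b + h \<in> {0..1}"
        using t R by (auto simp: b_def split: if_splits)
      then show ?thesis by (auto simp: g_def h_def[symmetric] t iso)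
    qed
    have sep: "dist (g i) (g j) > 2 * \<delta>" if "i \<noteq> j" for i j
    proof -
      have "dist (g i) (g j) = 3 * \<delta> * \<bar>real i - real j\<bar>"
        using \<delta> by (simp add: g_def iso abs_mult flip: right_diff_distrib)
      moreover have "\<bar>real i - real j\<bar> \<ge> 1" using that by linarith
      then have "3 * \<delta> * \<bar>real i - real j\<bar> \<ge> 3 * \<delta> * 1"
        using \<delta> by (intro mult_left_mono) auto
      ultimately show ?thesis using \<delta> by linarith
    qed
    have "inj_on g {..m}"
    proof (intro inj_onI, rule ccontr)
      fix i j assume "g i = g j" "i \<noteq> j"
      with sep[of i j] \<delta> show False by simp
    qed
    then have "m + 1 = card (g ` {..m})" by (simp add: card_image)
    also have "\<dots> \<le> covering_number \<delta> (cball x R \<inter> f ` {0..1})"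
    proof (rule covering_number_ge_separated)
      show "bounded (cball x R \<inter> f ` {0..1})" by (simp add: bounded_Int)
      show "dist p q > 2 * \<delta>" if "p \<in> g ` {..m}" "q \<in> g ` {..m}" "p \<noteq> q" for p q
        using that sep by (metis imageE)
    qed (use g \<delta> in auto)
    finally show "m + 1 \<le> covering_number \<delta> (cball x R \<inter> f ` {0..1})" .
  qed auto
  moreover have "1 / 6 * R powr (- \<phi> R * 1) \<le> real (m + 1)"
    using m(2) \<delta> by (simp add: ratio field_simps)
  ultimately show "1 / 6 * R powr (- \<phi> R * 1)
      \<le> real (INF x\<in>f ` {0..1}. covering_number (R powr (1 + \<phi> R)) (cball x R \<inter> f ` {0..1}))"
    unfolding \<delta>_def by linarith
qed auto

section \<open>The comb\<close>

definition segment_point :: "real \<Rightarrow> real ^ 2" where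
  "segment_point t = vector [t, 0]"

definition row_point :: "nat \<Rightarrow> nat \<Rightarrow> real ^ 2" where
  "row_point n i = vector [real i / (real n)\<^sup>2, 1 / real n]"

definition row :: "nat \<Rightarrow> (real ^ 2) set" where
  "row n = row_point n ` {..n\<^sup>2}"

definition comb :: "(real ^ 2) set" where
  "comb = segment_point ` {0..1} \<union> (\<Union>n\<in>{1..}. row n)"

lemma dist_segment_point: "dist (segment_point s) (segment_point t) = \<bar>s - t\<bar>"
  by (simp add: segment_point_def dist_vec_def L2_set_def sum_2 dist_real_def)

lemma abs_nth_diff_le_dist: "\<bar>x $ k - y $ k\<bar> \<le> dist x y" for x y :: "real ^ 'n"
  using component_le_norm_cart[of "x - y" k] by (simp add: dist_norm)

lemma inverse_nat_gap:
  assumes "n \<ge> 1" "m \<ge> 1" "n \<noteq> m"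
  shows "1 / (2 * (real n)\<^sup>2) \<le> \<bar>1 / real n - 1 / real m\<bar>"
proof -
  have *: "real m \<le> 2 * real n * \<bar>real m - real n\<bar>"
  proof (cases "m < n")
    case True
    then have "real m \<le> 2 * real n * 1" by simp
    also have "\<dots> \<le> 2 * real n * \<bar>real m - real n\<bar>"
      using True by (intro mult_left_mono) auto
    finally show ?thesis .
  next
    case False
    define d where "d = real m - real n"
    have d: "d \<ge> 1" "real m = real n + d" using False assms(3) by (auto simp: d_def)
    have "real n * 1 \<le> real n * d" "1 * d \<le> real n * d"
      using d(1) assms(1) by (intro mult_left_mono mult_right_mono; simp)+
    then have "real n + d \<le> 2 * real n * d" by linarith
    moreover have "\<bar>real m - real n\<bar> = d" using d by simp
    ultimately show ?thesis using d(2) by simp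
  qed
  have "1 / real n - 1 / real m = (real m - real n) / (real n * real m)"
    using assms by (simp add: diff_frac_eq)
  then have "\<bar>1 / real n - 1 / real m\<bar> = \<bar>real m - real n\<bar> / (real n * real m)"
    by (simp add: abs_mult)
  with * show ?thesis using assms
    by (simp add: field_simps power2_eq_square)
qed

text \<open>
  Consecutive heights \<open>1 / n\<close> and \<open>1 / (n + 1)\<close> differ by about \<open>1 / n\<^sup>2\<close>, so the horizontal spacing
  \<open>1 / n\<^sup>2\<close> makes both kinds of gaps comparable.
\<close>

lemma dist_row_point_ge:
  assumes "n \<ge> 1" "m \<ge> 1" "(n, i) \<noteq> (m, j)"
  shows "1 / (2 * (real n)\<^sup>2) \<le> dist (row_point n i) (row_point m j)"
proof (cases "n = m")
  case True
  with assms have "\<bar>real i - real j\<bar> \<ge> 1" by auto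
  then have "1 / (2 * (real n)\<^sup>2) \<le> \<bar>real i - real j\<bar> / (real n)\<^sup>2"
    using assms by (simp add: field_simps)
  also have "\<dots> = \<bar>row_point n i $ 1 - row_point m j $ 1\<bar>"
    using True by (simp add: row_point_def flip: diff_divide_distrib)
  also have "\<dots> \<le> dist (row_point n i) (row_point m j)"
    by (rule abs_nth_diff_le_dist)
  finally show ?thesis .
next
  case False
  then have "1 / (2 * (real n)\<^sup>2) \<le> \<bar>row_point n i $ 2 - row_point m j $ 2\<bar>"
    using inverse_nat_gap[OF assms(1,2)] by (simp add: row_point_def)
  also have "\<dots> \<le> dist (row_point n i) (row_point m j)"
    by (rule abs_nth_diff_le_dist)
  finally show ?thesis .
qed

lemma row_point_isolated:
  assumes "n \<ge> 1" "q \<in> comb" "q \<noteq> row_point n i"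
  shows "1 / (2 * (real n)\<^sup>2) \<le> dist (row_point n i) q"
proof (cases "q \<in> segment_point ` {0..1}")
  case True
  have "1 / (2 * (real n)\<^sup>2) \<le> 1 / real n"
  proof (rule frac_le)
    have "real n * 1 \<le> real n * (2 * real n)"
      using assms(1) by (intro mult_left_mono) auto
    then show "real n \<le> 2 * (real n)\<^sup>2" by (simp add: power2_eq_square)
  qed (use assms(1) in auto)
  also have "\<dots> = \<bar>row_point n i $ 2 - q $ 2\<bar>"
    using True by (auto simp: row_point_def segment_point_def)
  also have "\<dots> \<le> dist (row_point n i) q"
    by (rule abs_nth_diff_le_dist)
  finally show ?thesis .
next
  case False
  then obtain m j where "m \<ge> 1" "q = row_point m j"
    using assms(2) by (auto simp: comb_def row_def)
  then show ?thesis using dist_row_point_ge[OF assms(1), of m i j] assms(3) by blast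
qed

text \<open>
  All but the first \<open>N\<close> rows lie in the strip of height \<open>1 / N\<close>, so the comb is an intersection of
  closed sets, each a strip together with finitely many points.
\<close>

lemma compact_comb: "compact comb"
proof -
  define strip where "strip N = cbox (vector [0, 0]) (vector [1, 1 / real N] :: real ^ 2)" for N :: nat
  have strip_iff: "q \<in> strip N \<longleftrightarrow> 0 \<le> q $ 1 \<and> q $ 1 \<le> 1 \<and> 0 \<le> q $ 2 \<and> q $ 2 \<le> 1 / real N" for q N
    by (auto simp: strip_def mem_box_cart forall_2)
  have row_subset: "row n \<subseteq> strip N" if "N \<ge> 1" "N \<le> n" for n N
  proof -
    have "real i / (real n)\<^sup>2 \<le> 1" if "i \<le> n\<^sup>2" for i
      using that \<open>N \<ge> 1\<close> \<open>N \<le> n\<close> by (simp add: field_simps flip: of_nat_power)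
    then show ?thesis
      using that by (auto simp: row_def row_point_def strip_iff frac_le)
  qed
  have eq: "comb = (\<Inter>N\<in>{1..}. strip N \<union> (\<Union>n\<in>{1..<N}. row n))"
  proof (intro equalityI subsetI INT_I)
    fix q and N :: nat assume q: "q \<in> comb" and N: "N \<in> {1..}"
    show "q \<in> strip N \<union> (\<Union>n\<in>{1..<N}. row n)"
    proof (cases "q \<in> segment_point ` {0..1}")
      case True
      then show ?thesis by (auto simp: segment_point_def strip_iff)
    next
      case False
      then obtain n where n: "n \<ge> 1" "q \<in> row n" using q by (auto simp: comb_def)
      show ?thesis
      proof (cases "n < N")
        case True
        with n show ?thesis by auto
      next
        case False
        with n N row_subset[of N n] show ?thesis by auto
      qed
    qed
  next
    fix q assume q: "q \<in> (\<Inter>N\<in>{1..}. strip N \<union> (\<Union>n\<in>{1..<N}. row n))"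
    show "q \<in> comb"
    proof (cases "\<exists>n\<ge>1. q \<in> row n")
      case True
      then show ?thesis by (auto simp: comb_def)
    next
      case False
      with q have strips: "q \<in> strip N" if "N \<ge> 1" for N
        using that by fastforce
      have "q $ 2 \<le> 0"
      proof (rule ccontr)
        assume "\<not> q $ 2 \<le> 0"
        then obtain N :: nat where "N \<noteq> 0" "inverse (real N) < q $ 2"
          using ex_inverse_of_nat_less[of "q $ 2"] by auto
        with strips[of N] show False by (simp add: strip_iff inverse_eq_divide)
      qed
      with strips[of 1] have "q = segment_point (q $ 1)" "q $ 1 \<in> {0..1}"
        by (auto simp: strip_iff segment_point_def vec_eq_iff forall_2)
      then show ?thesis by (auto simp: comb_def)
    qed
  qed
  have "closed comb"
    unfolding eq strip_def row_def
    by (intro closed_INT ballI closed_Un closed_cbox closed_UN finite_imp_closed) auto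
  moreover have "bounded comb"
  proof -
    have "comb \<subseteq> strip 1 \<union> (\<Union>n\<in>{1..<1}. row n)"
      unfolding eq by (rule INT_lower) simp
    then have "comb \<subseteq> strip 1" by simp
    then show ?thesis by (metis bounded_cbox bounded_subset strip_def)
  qed
  ultimately show ?thesis by (simp add: compact_eq_bounded_closed)
qed

lemma covering_number_comb_ge:
  assumes "r > 0" "16 * r * (real N)\<^sup>2 < 1" "N \<ge> 1"
  shows "N ^ 3 \<le> covering_number r comb"
proof -
  define I where "I = {N<..2 * N} \<times> {..<N\<^sup>2}"
  have sep: "dist (case_prod row_point a) (case_prod row_point b) > 2 * r"
    if "a \<in> I" "b \<in> I" "a \<noteq> b" for a b
  proof -
    obtain n i m j where ab: "a = (n, i)" "b = (m, j)" by fastforce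
    with that have n: "n \<ge> 1" "n \<le> 2 * N" "m \<ge> 1" by (auto simp: I_def)
    have "real n \<le> 2 * real N" using n by linarith
    then have "(real n)\<^sup>2 \<le> (2 * real N)\<^sup>2" by (intro power_mono) auto
    then have "(real n)\<^sup>2 \<le> 4 * (real N)\<^sup>2" by (simp add: power_mult_distrib)
    then have "r * (real n)\<^sup>2 \<le> r * (4 * (real N)\<^sup>2)" using assms(1) by (intro mult_left_mono) auto
    with assms(2) have "2 * r < 1 / (2 * (real n)\<^sup>2)"
      using n by (simp add: field_simps)
    also have "\<dots> \<le> dist (row_point n i) (row_point m j)"
      using dist_row_point_ge n that ab by auto
    finally show ?thesis by (simp add: ab)
  qed
  have "inj_on (case_prod row_point) I"
  proof (rule inj_onI, rule ccontr)
    fix a b assume "a \<in> I" "b \<in> I" "case_prod row_point a = case_prod row_point b" "a \<noteq> b"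
    with sep[of a b] assms(1) show False by simp
  qed
  then have "card (case_prod row_point ` I) = N * N\<^sup>2"
    by (simp add: card_image I_def card_cartesian_product)
  moreover have "case_prod row_point ` I \<subseteq> comb"
  proof (clarify)
    fix n i assume "(n, i) \<in> I"
    then have "N \<le> n" "n \<ge> 1" "i < N\<^sup>2" by (auto simp: I_def)
    moreover from this have "N\<^sup>2 \<le> n\<^sup>2" by (intro power_mono) auto
    ultimately have "i \<le> n\<^sup>2" by linarith
    then have "row_point n i \<in> row n" by (simp add: row_def)
    with \<open>n \<ge> 1\<close> show "row_point n i \<in> comb" by (auto simp: comb_def)
  qed
  then have "card (case_prod row_point ` I) \<le> covering_number r comb"
  proof (intro covering_number_ge_separated)
    show "dist p q > 2 * r"
      if pq: "p \<in> case_prod row_point ` I" "q \<in> case_prod row_point ` I" "p \<noteq> q" for p q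
    proof -
      obtain a where a: "a \<in> I" "p = case_prod row_point a"
        using pq(1) by blast
      obtain b where b: "b \<in> I" "q = case_prod row_point b"
        using pq(2) by blast
      have "a \<noteq> b" using pq(3) a(2) b(2) by blast
      with sep[OF a(1) b(1)] a(2) b(2) show ?thesis by simp
    qed
  qed (use assms(1) compact_imp_bounded[OF compact_comb] in auto)
  ultimately show ?thesis by (simp add: power2_eq_square power3_eq_cube)
qed

text \<open>
  The largest \<open>N\<close> admitted by the preceding lemma is of order \<open>r\<^bsup>-1/2\<^esup>\<close>, so the covering number is at
  least of order \<open>r\<^bsup>-3/2\<^esup>\<close>; a smaller exponent absorbs the constants.
\<close>

lemma lower_box_dim_comb_ge: "ereal (5 / 4) \<le> lower_box_dim comb"
  unfolding lower_box_dim_def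
proof (rule Liminf_bounded)
  have "\<forall>\<^sub>F r::real in at_right 0. r powr (- (5 / 4)) \<le> (1 / (5 * sqrt r) - 1) ^ 3"
    by real_asymp
  moreover have "\<forall>\<^sub>F r::real in at_right 0. 1 / (5 * sqrt r) > 2"
    by real_asymp
  moreover have "\<forall>\<^sub>F r::real in at_right 0. 0 < r \<and> r < 1"
    by (intro eventually_conj eventually_at_right_less eventually_at_rightI[of 0 1]) auto
  ultimately show "\<forall>\<^sub>F r in at_right 0.
      ereal (5 / 4) \<le> ereal (ln (real (covering_number r comb)) / ln (1 / r))"
  proof eventually_elim
    case (elim r)
    define N where "N = nat \<lfloor>1 / (5 * sqrt r)\<rfloor>"
    have N: "real N \<le> 1 / (5 * sqrt r)" "1 / (5 * sqrt r) - 1 < real N"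
      using elim(2,3) unfolding N_def by linarith+
    have "N \<ge> 1" using N(2) elim(2) by linarith
    have "(real N)\<^sup>2 \<le> (1 / (5 * sqrt r))\<^sup>2"
      using N(1) by (intro power_mono) auto
    also have "\<dots> = 1 / (25 * r)"
      using elim(3) by (simp add: power_divide power_mult_distrib)
    finally have "16 * r * (real N)\<^sup>2 < 1"
      using elim(3) by (simp add: field_simps)
    with elim(3) \<open>N \<ge> 1\<close> have "N ^ 3 \<le> covering_number r comb"
      by (intro covering_number_comb_ge) auto
    then have "real N ^ 3 \<le> real (covering_number r comb)"
      by (metis of_nat_le_iff of_nat_power)
    moreover have "(1 / (5 * sqrt r) - 1) ^ 3 \<le> real N ^ 3"
      using N(2) elim(2) by (intro power_mono) auto
    ultimately have le: "r powr (- (5 / 4)) \<le> real (covering_number r comb)"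
      using elim(1) by linarith
    have "5 / 4 * ln (1 / r) = ln (r powr (- (5 / 4)))"
      using elim(3) by (simp add: ln_div ln_powr)
    also have "\<dots> \<le> ln (real (covering_number r comb))"
      using le elim(3) by (intro ln_mono) auto
    finally show ?case
      using elim(3) by (simp add: field_simps ln_div)
  qed
qed

lemma phi_lower_dim_subset_comb_le_1:
  assumes \<phi>: "dimension_function \<phi>" and "E \<noteq> {}" "E \<subseteq> comb"
  shows "phi_lower_dim \<phi> E \<le> 1"
proof (cases "E \<subseteq> range segment_point")
  case True
  show ?thesis
    by (rule phi_lower_dim_line_le_1[OF \<phi> \<open>E \<noteq> {}\<close> True dist_segment_point])
next
  case False
  then obtain p where "p \<in> E" "p \<notin> segment_point ` {0..1}" by blast
  with assms(3) obtain n i where p: "row_point n i \<in> E" "n \<ge> 1"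
    by (auto simp: comb_def row_def)
  then have "phi_lower_dim \<phi> E \<le> 0"
    using row_point_isolated[OF p(2)] assms(3)
    by (intro phi_lower_dim_isolated_le_0[OF \<phi> p(1), of "1 / (2 * (real n)\<^sup>2)"]) auto
  also have "(0::ereal) \<le> 1" by simp
  finally show ?thesis .
qed

theorem theorem5:
  "\<exists>F :: (real ^ 2) set. compact F \<and> F \<noteq> {} \<and>
     (\<forall>\<phi>. dimension_function \<phi> \<longrightarrow>
        phi_lower_dim \<phi> F = quasi_phi_lower_dim \<phi> F \<and>
        quasi_phi_lower_dim \<phi> F < phi_modified_lower_dim \<phi> F \<and>
        phi_modified_lower_dim \<phi> F < lower_box_dim F)"
proof (intro exI[of _ comb] conjI allI impI)
  show "compact comb" by (rule compact_comb)
  have p: "row_point 1 0 \<in> comb" by (auto simp: comb_def row_def)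
  then show nonempty: "comb \<noteq> {}" by blast
  fix \<phi> :: "real \<Rightarrow> real" assume \<phi>: "dimension_function \<phi>"
  have "phi_lower_dim \<phi> comb \<le> 0"
    using row_point_isolated[of 1 _ 0]
    by (intro phi_lower_dim_isolated_le_0[OF \<phi> p, of "1 / 2"]) auto
  with quasi_phi_lower_dim_le_phi_lower_dim[OF \<phi>, of comb]
    quasi_phi_lower_dim_nonneg[OF nonempty, of \<phi>]
  have zero: "phi_lower_dim \<phi> comb = 0" "quasi_phi_lower_dim \<phi> comb = 0"
    by (meson order.antisym order.trans)+
  then show "phi_lower_dim \<phi> comb = quasi_phi_lower_dim \<phi> comb" by simp
  have "1 \<le> phi_lower_dim \<phi> (segment_point ` {0..1})"
    by (rule phi_lower_dim_segment_ge_1[OF dist_segment_point])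
  also have "\<dots> \<le> phi_modified_lower_dim \<phi> comb"
    unfolding phi_modified_lower_dim_def
    by (intro Sup_upper CollectI exI[of _ "segment_point ` {0..1}"]) (auto simp: comb_def)
  finally have "1 \<le> phi_modified_lower_dim \<phi> comb" .
  moreover have "(0::ereal) < 1" by simp
  ultimately show "quasi_phi_lower_dim \<phi> comb < phi_modified_lower_dim \<phi> comb"
    unfolding zero by (rule less_le_trans[rotated])
  have "phi_modified_lower_dim \<phi> comb \<le> 1"
    unfolding phi_modified_lower_dim_def
    by (rule Sup_least) (auto intro: phi_lower_dim_subset_comb_le_1[OF \<phi>])
  also have "(1::ereal) < ereal (5 / 4)" by (simp add: one_ereal_def)
  also have "\<dots> \<le> lower_box_dim comb" by (rule lower_box_dim_comb_ge)
  finally show "phi_modified_lower_dim \<phi> comb < lower_box_dim comb" .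
qed

end
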